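(* Let $\mathbf{p}=(\mathbf{p}_1,\dots,\mathbf{p}_N)$ be a configuration of points in $\mathbb{E}^n$. Then the functions $V_n(\mathbf{p},r)=\mathrm{Vol}_n[\bigcup_{i=1}^NB_n(\mathbf{p}_i,r)]$ and $V^n(\mathbf{p},r)=\mathrm{Vol}_n[\bigcap_{i=1}^NB_n(\mathbf{p}_i,r)]$ are, for all sufficiently large real $r$, the restrictions of functions holomorphic in a punctured neighborhood $\{r\in\mathbb{C}:|r|>R\}$ of $r=\infty$, each having a pole of order exactly $n$ at $r=\infty$.
   Context: $B_n(\mathbf{x},r)$ denotes the closed $n$-dimensional ball of radius $r$ centered at $\mathbf{x}$, and $\mathrm{Vol}_n$ is $n$-dimensional volume. *)

theory Defs
  imports "HOL-Analysis.Analysis"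
begin

text \<open>A function f, holomorphic on a punctured neighbourhood of infinity, has a pole of
  order exactly n at infinity iff w \<mapsto> f(1/w) has a pole of order exactly n at w = 0, i.e.
  w^n f(1/w) extends to a function h holomorphic near 0 with h 0 \<noteq> 0.\<close>
definition pole_of_order_at_infinity :: "(complex \<Rightarrow> complex) \<Rightarrow> nat \<Rightarrow> bool" where
  "pole_of_order_at_infinity f n \<longleftrightarrow>
     (\<exists>\<rho>>0. \<exists>h. h holomorphic_on ball 0 \<rho> \<and> h 0 \<noteq> 0 \<and>
        (\<forall>w. 0 < norm w \<and> norm w < \<rho> \<longrightarrow> w ^ n * f (inverse w) = h w))"

definition union_vol :: "nat \<Rightarrow> (nat \<Rightarrow> 'a::euclidean_space) \<Rightarrow> real \<Rightarrow> real" where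
  "union_vol N p r = measure lebesgue (\<Union>i<N. cball (p i) r)"

definition inter_vol :: "nat \<Rightarrow> (nat \<Rightarrow> 'a::euclidean_space) \<Rightarrow> real \<Rightarrow> real" where
  "inter_vol N p r = measure lebesgue (\<Inter>i<N. cball (p i) r)"

end

theory Submission
  imports Defs "HOL-Complex_Analysis.Cauchy_Integral_Theorem"
begin

text \<open>
  Cut the union (intersection) of the balls into pieces by the nearest-point (farthest-point)
  Voronoi diagram of the centres. After translation and scaling by \<open>t = 1/r\<close>, a piece is the part
  of the unit ball cut out by inequalities \<open>a \<bullet> x \<le> t b\<close>, and it remains to see that its volume
  \<open>F t\<close> is given, for small \<open>t > 0\<close>, by a function holomorphic near \<open>0\<close>.

  Taking complements, one may assume \<open>b = 0\<close> or \<open>b = 1\<close>. Then the region grows with \<open>t\<close>, and between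
  \<open>t1\<close> and \<open>t2\<close> it sweeps out, for each inequality with \<open>b = 1\<close>, the points at which \<open>a \<bullet> x\<close> is maximal
  and lies in \<open>[t1, t2]\<close>. Slicing this set orthogonally to \<open>a\<close> expresses \<open>F t2 - F t1\<close> as a sum of integrals
  of volumes of regions of the same kind, one dimension lower and in balls of radius
  \<open>sqrt (1 - s^2)\<close>. By induction on the dimension the integrands are analytic, hence so is \<open>F\<close>.
  The pole has order exactly \<open>n\<close> because both volumes are at least a positive multiple of \<open>r ^ n\<close>.

  To keep the induction inside one Euclidean space, a region of lower dimension is
  thickened by the unit interval in each of the orthonormal directions already used.
\<close>

section \<open>Slicing orthogonally to a unit vector\<close>

text \<open>The section of \<open>X\<close> by the hyperplane \<open>u \<bullet> x = s\<close>, thickened by the unit interval along \<open>u\<close>.\<close>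
definition slice :: "'a::euclidean_space \<Rightarrow> 'a set \<Rightarrow> real \<Rightarrow> 'a set" where
  "slice u X s = {x. 0 \<le> u \<bullet> x \<and> u \<bullet> x \<le> 1 \<and> x - (u \<bullet> x) *\<^sub>R u + s *\<^sub>R u \<in> X}"

lemma nn_integral_lborel_translate:
  fixes f :: "'a::euclidean_space \<Rightarrow> ennreal"
  assumes [measurable]: "f \<in> borel_measurable borel"
  shows "(\<integral>\<^sup>+x. f (x + c) \<partial>lborel) = (\<integral>\<^sup>+x. f x \<partial>lborel)"
proof -
  have "(\<integral>\<^sup>+x. f x \<partial>lborel) = (\<integral>\<^sup>+x. f x \<partial>distr lborel borel ((+) c))"
    by (simp add: lborel_distr_plus)
  also have "\<dots> = (\<integral>\<^sup>+x. f (c + x) \<partial>lborel)"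
    by (subst nn_integral_distr) auto
  finally show ?thesis by (simp add: add.commute)
qed

text \<open>The map \<open>(s, x) \<mapsto> (- (u \<bullet> x), x - (u \<bullet> x) u + s u)\<close> is a composition of three
  shears, each of which preserves the product measure by translation invariance.\<close>
lemma slice_Fubini:
  fixes u :: "'a::euclidean_space"
  assumes u: "norm u = 1" and X [measurable]: "X \<in> sets borel"
  shows "emeasure lborel X = (\<integral>\<^sup>+s. emeasure lborel (slice u X s) \<partial>lborel)"
proof -
  have uu: "u \<bullet> u = 1" using u by (simp add: norm_eq_1)
  \<comment> \<open>The auxiliary interval has length 1, so the double integral of \<open>f\<close>
    is the measure of \<open>X\<close>. It is \<open>[-1, 0]\<close> because the shears leave
    \<open>- (u \<bullet> x)\<close> in the first argument, which makes the condition
    \<open>0 \<le> u \<bullet> x \<le> 1\<close> of \<open>slice\<close>.\<close>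
  define f :: "real \<Rightarrow> 'a \<Rightarrow> ennreal" where
    "f s x = indicator {-1..0} s * indicator X x" for s x
  have [measurable]: "(\<lambda>z. f (g z) (h z)) \<in> borel_measurable M"
    if "g \<in> borel_measurable M" "h \<in> borel_measurable M" for M :: "'b measure" and g h
    unfolding f_def using that by measurable
  have "emeasure lborel X = (\<integral>\<^sup>+s. \<integral>\<^sup>+x. f s x \<partial>lborel \<partial>lborel)"
    unfolding f_def by (simp add: nn_integral_cmult nn_integral_multc)
  also have "\<dots> = (\<integral>\<^sup>+s. \<integral>\<^sup>+x. f s (x + s *\<^sub>R u) \<partial>lborel \<partial>lborel)"
    by (subst nn_integral_lborel_translate) auto
  also have "\<dots> = (\<integral>\<^sup>+x. \<integral>\<^sup>+s. f s (x + s *\<^sub>R u) \<partial>lborel \<partial>lborel)"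
    by (subst lborel_pair.Fubini') auto
  also have "\<dots> = (\<integral>\<^sup>+x. \<integral>\<^sup>+s. f (s + - (u \<bullet> x)) (x + (s + - (u \<bullet> x)) *\<^sub>R u) \<partial>lborel \<partial>lborel)"
    by (rule nn_integral_cong, rule sym,
        rule nn_integral_lborel_translate[where f = "\<lambda>s. f s (_ + s *\<^sub>R u)"]) auto
  also have "\<dots> = (\<integral>\<^sup>+s. \<integral>\<^sup>+x. f (s + - (u \<bullet> x)) (x + (s + - (u \<bullet> x)) *\<^sub>R u) \<partial>lborel \<partial>lborel)"
    by (subst lborel_pair.Fubini') auto
  also have "\<dots> = (\<integral>\<^sup>+s. \<integral>\<^sup>+x. f (s + - (u \<bullet> (x + s *\<^sub>R u)))
                    ((x + s *\<^sub>R u) + (s + - (u \<bullet> (x + s *\<^sub>R u))) *\<^sub>R u) \<partial>lborel \<partial>lborel)"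
    by (rule nn_integral_cong, rule sym,
        rule nn_integral_lborel_translate[where f = "\<lambda>x. f (_ + - (u \<bullet> x)) (x + (_ + - (u \<bullet> x)) *\<^sub>R u)"]) auto
  also have "\<dots> = (\<integral>\<^sup>+s. \<integral>\<^sup>+x. indicator (slice u X s) x \<partial>lborel \<partial>lborel)"
    by (intro nn_integral_cong)
       (auto simp: f_def slice_def indicator_def inner_simps uu algebra_simps)
  also have "\<dots> = (\<integral>\<^sup>+s. emeasure lborel (slice u X s) \<partial>lborel)"
    by (subst nn_integral_indicator) (auto simp: slice_def)
  finally show ?thesis .
qed

lemma compact_slice:
  fixes u :: "'a::euclidean_space"
  assumes u: "norm u = 1" and X: "compact X"
  shows "compact (slice u X s)"
proof -
  obtain B where B: "\<And>x. x \<in> X \<Longrightarrow> norm x \<le> B"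
    using compact_imp_bounded[OF X] by (auto simp: bounded_iff)
  have "norm x \<le> B + 1 + \<bar>s\<bar>" if "x \<in> slice u X s" for x
  proof -
    have 1: "norm (x - (u \<bullet> x) *\<^sub>R u + s *\<^sub>R u) \<le> B" "0 \<le> u \<bullet> x" "u \<bullet> x \<le> 1"
      using that B by (auto simp: slice_def)
    have "x = (x - (u \<bullet> x) *\<^sub>R u + s *\<^sub>R u) + ((u \<bullet> x) *\<^sub>R u - s *\<^sub>R u)" by simp
    then have "norm x \<le> B + norm ((u \<bullet> x) *\<^sub>R u - s *\<^sub>R u)"
      using 1 norm_triangle_le by (metis add_mono_thms_linordered_semiring(3))
    also have "norm ((u \<bullet> x) *\<^sub>R u - s *\<^sub>R u) \<le> 1 + \<bar>s\<bar>"
      by (rule norm_triangle_le_diff) (use 1 u in auto)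
    finally show ?thesis by simp
  qed
  then have "bounded (slice u X s)" by (auto simp: bounded_iff)
  moreover have "slice u X s = {x. 0 \<le> u \<bullet> x} \<inter> {x. u \<bullet> x \<le> 1} \<inter>
      (\<lambda>x. x - (u \<bullet> x) *\<^sub>R u + s *\<^sub>R u) -` X"
    by (auto simp: slice_def)
  then have "closed (slice u X s)"
    by (auto intro!: closed_Int closed_Collect_le continuous_intros
          continuous_closed_vimage compact_imp_closed[OF X])
  ultimately show ?thesis by (simp add: compact_eq_bounded_closed)
qed

lemma measurable_measure_slice:
  fixes u :: "'a::euclidean_space"
  assumes [measurable]: "X \<in> sets borel"
  shows "(\<lambda>s. measure lborel (slice u X s)) \<in> borel_measurable borel"
proof -
  have "{z \<in> space (borel \<Otimes>\<^sub>M borel). snd z \<in> slice u X (fst z)} \<in> sets (borel \<Otimes>\<^sub>M (borel :: 'a measure))"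
    unfolding slice_def by measurable
  then have "(\<lambda>s. emeasure lborel (Pair s -` {z \<in> space (borel \<Otimes>\<^sub>M borel). snd z \<in> slice u X (fst z)}))
      \<in> borel_measurable borel"
    by (intro lborel.measurable_emeasure_Pair) (simp cong: sets_pair_measure_cong)
  then have "(\<lambda>s. emeasure lborel (slice u X s)) \<in> borel_measurable borel"
    by (simp add: vimage_def space_pair_measure)
  then show ?thesis unfolding measure_def by measurable
qed

text \<open>Fubini plus the fundamental theorem of calculus: slices at heights outside
  \<open>{\<alpha>..\<beta>}\<close> are empty, and inside their volume is the derivative of
  \<Phi>.\<close>

lemma measure_slab:
  fixes u :: "'a::euclidean_space"
  assumes u: "norm u = 1" and X: "compact X" and sub: "\<And>x. x \<in> X \<Longrightarrow> \<alpha> \<le> u \<bullet> x \<and> u \<bullet> x \<le> \<beta>"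
    and "\<alpha> \<le> \<beta>"
    and deriv: "\<And>s. \<alpha> \<le> s \<Longrightarrow> s \<le> \<beta> \<Longrightarrow>
      (\<Phi> has_real_derivative measure lebesgue (slice u X s)) (at s)"
  shows "measure lebesgue X = \<Phi> \<beta> - \<Phi> \<alpha>"
proof -
  have uu: "u \<bullet> u = 1" using u by (simp add: norm_eq_1)
  have bX: "X \<in> sets borel" using X by (simp add: borel_compact)
  have bS: "slice u X s \<in> sets borel" for s using compact_slice[OF u X] by (simp add: borel_compact)
  have eq: "emeasure lborel (slice u X s) =
      ennreal (measure lborel (slice u X s)) * indicator {\<alpha>..\<beta>} s" for s
  proof (cases "s \<in> {\<alpha>..\<beta>}")
    case True
    then show ?thesis
      using emeasure_compact_finite[OF compact_slice[OF u X], of s]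
      by (simp add: emeasure_eq_ennreal_measure less_top)
  next
    case False
    have "slice u X s = {}"
      using False sub by (fastforce simp: slice_def inner_simps uu)
    then show ?thesis by simp
  qed
  have d: "(\<Phi> has_real_derivative measure lborel (slice u X s)) (at s)" if "s \<in> {\<alpha>..\<beta>}" for s
    using deriv[of s] that bS by simp
  \<comment> \<open>\<open>ennreal\<close> sends negative reals to 0, so the sign of the difference
    must be known before returning to real numbers.\<close>
  have le: "\<Phi> \<alpha> \<le> \<Phi> \<beta>"
    by (rule DERIV_nonneg_imp_nondecreasing[OF \<open>\<alpha> \<le> \<beta>\<close>]) (use d in force)
  have "emeasure lborel X = (\<integral>\<^sup>+s. ennreal (measure lborel (slice u X s)) * indicator {\<alpha>..\<beta>} s \<partial>lborel)"
    by (subst slice_Fubini[OF u bX]) (simp add: eq)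
  also have "\<dots> = ennreal (\<Phi> \<beta> - \<Phi> \<alpha>)"
    by (rule nn_integral_FTC_Icc) (use d measurable_measure_slice[OF bX] \<open>\<alpha> \<le> \<beta>\<close> in auto)
  finally have "measure lborel X = \<Phi> \<beta> - \<Phi> \<alpha>"
    using le by (simp add: measure_def)
  then show ?thesis using bX by simp
qed

text \<open>\<open>Y\<close> is a cylinder along \<open>u\<close>, so its slices at heights in
  \<open>{0..w}\<close> all coincide and the integral over the height contributes the factor
  \<open>w\<close>. This corrects the side of a thickening interval after a dilation.\<close>

lemma emeasure_widen:
  fixes u :: "'a::euclidean_space"
  assumes u: "norm u = 1" and Y [measurable]: "Y \<in> sets borel"
    and inv: "\<And>x s. x + s *\<^sub>R u \<in> Y \<longleftrightarrow> x \<in> Y" and "0 \<le> w"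
  shows "emeasure lborel {x\<in>Y. 0 \<le> u \<bullet> x \<and> u \<bullet> x \<le> w} =
         ennreal w * emeasure lborel {x\<in>Y. 0 \<le> u \<bullet> x \<and> u \<bullet> x \<le> 1}"
proof -
  have uu: "u \<bullet> u = 1" using u by (simp add: norm_eq_1)
  have inv': "x - (u \<bullet> x) *\<^sub>R u + s *\<^sub>R u \<in> Y \<longleftrightarrow> x \<in> Y" for x s
    using inv[of x "s - u \<bullet> x"] by (simp add: algebra_simps)
  have "emeasure lborel {x\<in>Y. 0 \<le> u \<bullet> x \<and> u \<bullet> x \<le> w} =
     (\<integral>\<^sup>+s. emeasure lborel (slice u {x\<in>Y. 0 \<le> u \<bullet> x \<and> u \<bullet> x \<le> w} s) \<partial>lborel)"
    by (rule slice_Fubini[OF u]) measurable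
  also have "\<dots> = (\<integral>\<^sup>+s. emeasure lborel {x\<in>Y. 0 \<le> u \<bullet> x \<and> u \<bullet> x \<le> 1} * indicator {0..w} s \<partial>lborel)"
  proof (rule nn_integral_cong)
    fix s :: real
    have "slice u {x\<in>Y. 0 \<le> u \<bullet> x \<and> u \<bullet> x \<le> w} s =
        (if s \<in> {0..w} then {x\<in>Y. 0 \<le> u \<bullet> x \<and> u \<bullet> x \<le> 1} else {})"
      by (auto simp: slice_def inv' inner_simps uu)
    then show "emeasure lborel (slice u {x\<in>Y. 0 \<le> u \<bullet> x \<and> u \<bullet> x \<le> w} s) =
        emeasure lborel {x\<in>Y. 0 \<le> u \<bullet> x \<and> u \<bullet> x \<le> 1} * indicator {0..w} s" by simp
  qed
  also have "\<dots> = emeasure lborel {x\<in>Y. 0 \<le> u \<bullet> x \<and> u \<bullet> x \<le> 1} * emeasure lborel {0..w}"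
    by (rule nn_integral_cmult_indicator) simp
  also have "\<dots> = ennreal w * emeasure lborel {x\<in>Y. 0 \<le> u \<bullet> x \<and> u \<bullet> x \<le> 1}"
    using \<open>0 \<le> w\<close> by (simp only: emeasure_lborel_Icc diff_zero mult.commute)
  finally show ?thesis .
qed

section \<open>Functions analytic at 0 from the right\<close>

text \<open>One-sided because the volumes are in general not analytic across 0: already the length
  of the interval cut out by \<open>0 \<le> x\<close> and \<open>x \<le> t\<close> is
  \<open>t\<close> for small positive \<open>t\<close> and 0 for negative \<open>t\<close>.\<close>

definition right_analytic :: "(real \<Rightarrow> real) \<Rightarrow> bool" where
  "right_analytic F \<longleftrightarrow> (\<exists>\<epsilon>>0. \<exists>h. h holomorphic_on ball 0 \<epsilon> \<and>
     (\<forall>t. 0 < t \<and> t < \<epsilon> \<longrightarrow> h (complex_of_real t) = complex_of_real (F t)))"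

lemma right_analyticE:
  assumes "right_analytic F"
  obtains \<epsilon> h where "\<epsilon> > 0" "h holomorphic_on ball 0 \<epsilon>"
    "\<And>t. 0 < t \<Longrightarrow> t < \<epsilon> \<Longrightarrow> h (complex_of_real t) = complex_of_real (F t)"
  using assms unfolding right_analytic_def by blast

lemma right_analyticI:
  assumes "\<epsilon> > 0" "h holomorphic_on ball 0 \<epsilon>"
    "\<And>t. 0 < t \<Longrightarrow> t < \<epsilon> \<Longrightarrow> h (complex_of_real t) = complex_of_real (F t)"
  shows "right_analytic F"
  using assms unfolding right_analytic_def by blast

lemma right_analytic_cong:
  assumes F: "right_analytic F" and "\<delta> > 0" and eq: "\<And>t. 0 < t \<Longrightarrow> t < \<delta> \<Longrightarrow> G t = F t"
  shows "right_analytic G"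
proof -
  obtain \<epsilon> h where "\<epsilon> > 0" "h holomorphic_on ball 0 \<epsilon>"
    "\<And>t. 0 < t \<Longrightarrow> t < \<epsilon> \<Longrightarrow> h (complex_of_real t) = complex_of_real (F t)"
    using right_analyticE[OF F] by blast
  then show ?thesis
    using \<open>\<delta> > 0\<close> eq
    by (intro right_analyticI[where \<epsilon> = "min \<epsilon> \<delta>" and h = h])
       (auto intro: holomorphic_on_subset)
qed

lemma right_analytic_const: "right_analytic (\<lambda>_. c)"
  by (rule right_analyticI[where \<epsilon> = 1 and h = "\<lambda>_. complex_of_real c"]) auto

lemma right_analytic_binop:
  assumes F: "right_analytic F" and G: "right_analytic G"
    and op: "\<And>x y. opc (complex_of_real x) (complex_of_real y) = complex_of_real (opr x y)"
    and hol: "\<And>S f g. f holomorphic_on S \<Longrightarrow> g holomorphic_on S \<Longrightarrow> (\<lambda>z. opc (f z) (g z)) holomorphic_on S"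
  shows "right_analytic (\<lambda>t. opr (F t) (G t))"
proof -
  obtain \<epsilon> h where "\<epsilon> > 0" "h holomorphic_on ball 0 \<epsilon>"
    "\<And>t. 0 < t \<Longrightarrow> t < \<epsilon> \<Longrightarrow> h (complex_of_real t) = complex_of_real (F t)"
    using right_analyticE[OF F] by blast
  moreover obtain \<delta> k where "\<delta> > 0" "k holomorphic_on ball 0 \<delta>"
    "\<And>t. 0 < t \<Longrightarrow> t < \<delta> \<Longrightarrow> k (complex_of_real t) = complex_of_real (G t)"
    using right_analyticE[OF G] by blast
  ultimately show ?thesis
    by (intro right_analyticI[where \<epsilon> = "min \<epsilon> \<delta>" and h = "\<lambda>z. opc (h z) (k z)"])
       (auto intro!: hol simp: op elim: holomorphic_on_subset)
qed

lemma right_analytic_add: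
  "right_analytic F \<Longrightarrow> right_analytic G \<Longrightarrow> right_analytic (\<lambda>t. F t + G t)"
  by (rule right_analytic_binop[where opc = "(+)" and opr = "(+)"]) (simp_all add: holomorphic_on_add)

lemma right_analytic_diff:
  "right_analytic F \<Longrightarrow> right_analytic G \<Longrightarrow> right_analytic (\<lambda>t. F t - G t)"
  by (rule right_analytic_binop[where opc = "(-)" and opr = "(-)"]) (simp_all add: holomorphic_on_diff)

lemma right_analytic_mult:
  "right_analytic F \<Longrightarrow> right_analytic G \<Longrightarrow> right_analytic (\<lambda>t. F t * G t)"
  by (rule right_analytic_binop[where opc = "(*)" and opr = "(*)"]) (simp_all add: holomorphic_on_mult)

lemma right_analytic_sum:
  "finite A \<Longrightarrow> (\<And>a. a \<in> A \<Longrightarrow> right_analytic (F a)) \<Longrightarrow> right_analytic (\<lambda>t. \<Sum>a\<in>A. F a t)"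
  by (induction A rule: finite_induct) (auto intro: right_analytic_const right_analytic_add)

text \<open>Continuity and \<open>\<phi> 0 = 0\<close> keep \<phi> inside the disc of
  \<open>h\<close>; \<open>g\<close> must be positive because \<open>h\<close> is tied to
  \<open>F\<close> only on the positive axis.\<close>

lemma right_analytic_compose:
  assumes F: "right_analytic F" and "\<delta> > 0" and hol: "\<phi> holomorphic_on ball 0 \<delta>" and "\<phi> 0 = 0"
    and g: "\<And>t. 0 < t \<Longrightarrow> t < \<delta> \<Longrightarrow> \<phi> (complex_of_real t) = complex_of_real (g t) \<and> 0 < g t"
  shows "right_analytic (\<lambda>t. F (g t))"
proof -
  obtain \<epsilon> h where h: "\<epsilon> > 0" "h holomorphic_on ball 0 \<epsilon>"
    "\<And>t. 0 < t \<Longrightarrow> t < \<epsilon> \<Longrightarrow> h (complex_of_real t) = complex_of_real (F t)"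
    using right_analyticE[OF F] by blast
  have "continuous (at 0) \<phi>"
    using holomorphic_on_imp_continuous_on[OF hol] \<open>\<delta> > 0\<close>
    by (simp add: continuous_on_eq_continuous_at)
  then obtain d where d: "d > 0" "\<And>z. dist z 0 < d \<Longrightarrow> dist (\<phi> z) (\<phi> 0) < \<epsilon>"
    unfolding continuous_at_eps_delta using \<open>\<epsilon> > 0\<close> by blast
  show ?thesis
  proof (rule right_analyticI[where \<epsilon> = "min \<delta> d" and h = "h \<circ> \<phi>"])
    show "h \<circ> \<phi> holomorphic_on ball 0 (min \<delta> d)"
    proof (rule holomorphic_on_compose_gen[OF _ h(2)])
      show "\<phi> holomorphic_on ball 0 (min \<delta> d)" by (rule holomorphic_on_subset[OF hol]) auto
      show "\<phi> ` ball 0 (min \<delta> d) \<subseteq> ball 0 \<epsilon>"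
        using d \<open>\<phi> 0 = 0\<close> by (auto simp: dist_commute)
    qed
  next
    fix t :: real assume t: "0 < t" "t < min \<delta> d"
    then have "norm (\<phi> (complex_of_real t)) < \<epsilon>"
      using d(2)[of "complex_of_real t"] \<open>\<phi> 0 = 0\<close> by simp
    then show "(h \<circ> \<phi>) (complex_of_real t) = complex_of_real (F (g t))"
      using g[of t] t h(3)[of "g t"] by simp
  qed (use \<open>\<delta> > 0\<close> d in auto)
qed

lemma right_analytic_dilate:
  assumes "right_analytic F" "0 < c"
  shows "right_analytic (\<lambda>t. F (t / c))"
  by (rule right_analytic_compose[OF assms(1), where \<phi> = "\<lambda>z. z / of_real c" and g = "\<lambda>t. t / c" and \<delta> = 1])
     (use assms in \<open>auto intro!: holomorphic_intros\<close>)

lemma one_minus_square_not_nonpos: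
  assumes "z \<in> ball 0 (1::real)"
  shows "1 - (z::complex)\<^sup>2 \<notin> \<real>\<^sub>\<le>\<^sub>0"
proof
  assume "1 - z\<^sup>2 \<in> \<real>\<^sub>\<le>\<^sub>0"
  then have "Re (z\<^sup>2) \<ge> 1" by (simp add: complex_nonpos_Reals_iff)
  moreover have "norm (z\<^sup>2) < 1" using assms by (simp add: norm_power power_less_one_iff)
  ultimately show False using complex_Re_le_cmod[of "z\<^sup>2"] by linarith
qed

lemma csqrt_one_minus_square:
  assumes "0 < t" "t < (1::real)"
  shows "csqrt (1 - (complex_of_real t)\<^sup>2) = complex_of_real (sqrt (1 - t\<^sup>2))" "0 < sqrt (1 - t\<^sup>2)"
proof -
  have p: "0 < 1 - t\<^sup>2" using assms by (simp add: power_less_one_iff)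
  have "csqrt (complex_of_real (1 - t\<^sup>2)) = complex_of_real (sqrt (1 - t\<^sup>2))"
    by (rule of_real_sqrt[symmetric]) (use p in simp)
  then show "csqrt (1 - (complex_of_real t)\<^sup>2) = complex_of_real (sqrt (1 - t\<^sup>2))" by simp
  show "0 < sqrt (1 - t\<^sup>2)" using p by simp
qed

text \<open>The form taken by the volume of a region in a ball of radius
  \<open>sqrt (1 - s^2)\<close> after rescaling to the unit ball, with \<open>n\<close> the
  dimension and \<open>m\<close> the number of thickened directions. On the unit disc
  \<open>1 - z^2\<close> avoids the nonpositive reals, so the principal root is holomorphic and
  nonzero there.\<close>

lemma right_analytic_sqrt_substitution:
  assumes "right_analytic F"
  shows "right_analytic (\<lambda>s. sqrt (1 - s\<^sup>2) ^ n * (1 / sqrt (1 - s\<^sup>2)) ^ m * F (s / sqrt (1 - s\<^sup>2)))"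
proof (rule right_analytic_mult)
  have nz: "csqrt (1 - z\<^sup>2) \<noteq> 0" if "z \<in> ball 0 1" for z
    using one_minus_square_not_nonpos[OF that] by auto
  have hol: "(\<lambda>z. csqrt (1 - z\<^sup>2)) holomorphic_on ball 0 1"
    by (intro holomorphic_intros one_minus_square_not_nonpos)
  show "right_analytic (\<lambda>s. sqrt (1 - s\<^sup>2) ^ n * (1 / sqrt (1 - s\<^sup>2)) ^ m)"
  proof (rule right_analyticI[where \<epsilon> = 1 and h = "\<lambda>z. csqrt (1 - z\<^sup>2) ^ n * (1 / csqrt (1 - z\<^sup>2)) ^ m"])
    show "(\<lambda>z. csqrt (1 - z\<^sup>2) ^ n * (1 / csqrt (1 - z\<^sup>2)) ^ m) holomorphic_on ball 0 1"
      by (intro holomorphic_on_mult holomorphic_on_power holomorphic_on_divide holomorphic_on_const hol nz)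
  qed (simp_all add: csqrt_one_minus_square)
  show "right_analytic (\<lambda>s. F (s / sqrt (1 - s\<^sup>2)))"
  proof (rule right_analytic_compose[OF assms, where \<phi> = "\<lambda>z. z / csqrt (1 - z\<^sup>2)" and \<delta> = 1])
    show "(\<lambda>z. z / csqrt (1 - z\<^sup>2)) holomorphic_on ball 0 1"
      by (intro holomorphic_on_divide holomorphic_on_ident hol nz)
    show "complex_of_real t / csqrt (1 - (complex_of_real t)\<^sup>2) = complex_of_real (t / sqrt (1 - t\<^sup>2)) \<and>
        0 < t / sqrt (1 - t\<^sup>2)" if "0 < t" "t < 1" for t
      using csqrt_one_minus_square[OF that] that by (simp only: of_real_divide divide_pos_pos simp_thms)
  qed simp_all
qed

text \<open>The integration step of the induction: a disc is convex, so \<open>h\<close> has a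
  holomorphic primitive on it, and its real part along the positive axis serves as
  \<open>F\<close>.\<close>

lemma right_analytic_primitive:
  assumes "right_analytic f"
  obtains \<epsilon> F where "\<epsilon> > 0" "right_analytic F"
    "\<And>t. 0 < t \<Longrightarrow> t < \<epsilon> \<Longrightarrow> (F has_real_derivative f t) (at t)"
proof -
  obtain \<epsilon> h where h: "\<epsilon> > 0" "h holomorphic_on ball 0 \<epsilon>"
    "\<And>t. 0 < t \<Longrightarrow> t < \<epsilon> \<Longrightarrow> h (complex_of_real t) = complex_of_real (f t)"
    using right_analyticE[OF assms] by blast
  obtain g0 where g0: "\<And>z. z \<in> ball 0 \<epsilon> \<Longrightarrow> (g0 has_field_derivative h z) (at z within ball 0 \<epsilon>)"
    using holomorphic_convex_primitive'[OF _ _ h(2)] by auto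
  \<comment> \<open>Vanishing at a real point makes \<open>g\<close> real on the whole interval.\<close>
  define g where "g z = g0 z - g0 (of_real (\<epsilon>/2))" for z
  have g: "(g has_field_derivative h z) (at z)" if "z \<in> ball 0 \<epsilon>" for z
    using DERIV_diff[OF g0[OF that] DERIV_const, of "g0 (of_real (\<epsilon>/2))"] at_within_open[OF that]
    by (simp add: g_def[abs_def])
  define F where "F t = Re (g (of_real t))" for t :: real
  have gd: "((\<lambda>t. g (of_real t)) has_vector_derivative of_real (f t)) (at t)" if "0 < t" "t < \<epsilon>" for t :: real
  proof -
    have "(g has_field_derivative of_real (f t)) (at (of_real t))"
      using g[of "of_real t"] h(3)[OF that] that by simp
    then have "(g \<circ> of_real has_vector_derivative (1 * of_real (f t))) (at t)"
      by (intro field_vector_diff_chain_at) (auto intro!: derivative_eq_intros)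
    then show ?thesis by (simp add: o_def)
  qed
  have "F t = Re (g (of_real t)) \<and> Im (g (of_real t)) = 0" if "0 < t" "t < \<epsilon>" for t
  proof -
    \<comment> \<open>Along the real axis the derivative of the imaginary part is the imaginary part
      of the real number \<open>f x\<close>, hence 0.\<close>
    have "\<exists>c. \<forall>x\<in>{0<..<\<epsilon>}. Im (g (of_real x)) = c"
    proof (rule has_field_derivative_zero_constant)
      show "convex {0<..<\<epsilon>}" by simp
      fix x assume x: "x \<in> {0<..<\<epsilon>}"
      have "((\<lambda>x. Im (g (of_real x))) has_vector_derivative Im (of_real (f x))) (at x)"
        using bounded_linear.has_vector_derivative[OF bounded_linear_Im gd[of x]] x by simp
      then show "((\<lambda>x. Im (g (of_real x))) has_field_derivative 0) (at x within {0<..<\<epsilon>})"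
        by (simp add: has_real_derivative_iff_has_vector_derivative has_vector_derivative_at_within)
    qed
    then obtain c where c: "\<And>x. 0 < x \<Longrightarrow> x < \<epsilon> \<Longrightarrow> Im (g (of_real x)) = c"
      by (auto simp del: of_real_divide)
    have "Im (g (of_real t)) = Im (g (of_real (\<epsilon>/2)))"
      by (subst (1 2) c) (use that in auto)
    also have "\<dots> = 0" by (simp add: g_def)
    finally have "Im (g (of_real t)) = 0" .
    then show ?thesis by (simp add: F_def)
  qed
  moreover have "g holomorphic_on ball 0 \<epsilon>"
    unfolding holomorphic_on_open[OF open_ball] using g by blast
  ultimately have "right_analytic F"
    using \<open>\<epsilon> > 0\<close>
    by (intro right_analyticI[where \<epsilon> = \<epsilon> and h = g]) (simp_all add: complex_eq_iff)
  moreover have "(F has_real_derivative f t) (at t)" if "0 < t" "t < \<epsilon>" for t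
    using bounded_linear.has_vector_derivative[OF bounded_linear_Re gd[OF that]]
    by (simp add: F_def[abs_def] has_real_derivative_iff_has_vector_derivative)
  ultimately show ?thesis using that \<open>\<epsilon> > 0\<close> by blast
qed

section \<open>Volumes of polyhedral regions in a ball\<close>

definition orthonormal :: "'a::euclidean_space set \<Rightarrow> bool" where
  "orthonormal E \<longleftrightarrow> pairwise orthogonal E \<and> (\<forall>e\<in>E. norm e = 1)"

lemma orthonormal_card_le:
  fixes E :: "'a::euclidean_space set"
  assumes "orthonormal E"
  shows "finite E" "card E \<le> DIM('a)"
proof -
  have "independent E"
    using assms unfolding orthonormal_def by (intro pairwise_orthogonal_independent) auto
  then show "finite E" "card E \<le> DIM('a)" using independent_bound by auto
qed

lemma orthonormal_insert:
  assumes "orthonormal E" "norm u = 1" "\<And>e. e \<in> E \<Longrightarrow> u \<bullet> e = 0"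
  shows "orthonormal (insert u E)" "u \<notin> E"
proof -
  show "orthonormal (insert u E)"
    using assms by (auto simp: orthonormal_def pairwise_insert orthogonal_def inner_commute)
  show "u \<notin> E" using assms(2,3) by (force simp: norm_eq_1)
qed

lemma emeasure_widen_orthonormal:
  fixes E :: "'a::euclidean_space set"
  assumes "finite E" "orthonormal E" "Y \<in> sets borel" "0 \<le> w"
    and "\<And>e x s. e \<in> E \<Longrightarrow> x + s *\<^sub>R e \<in> Y \<longleftrightarrow> x \<in> Y"
  shows "emeasure lborel {x\<in>Y. \<forall>e\<in>E. 0 \<le> e \<bullet> x \<and> e \<bullet> x \<le> w} =
         ennreal (w ^ card E) * emeasure lborel {x\<in>Y. \<forall>e\<in>E. 0 \<le> e \<bullet> x \<and> e \<bullet> x \<le> 1}"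
  using assms
proof (induction E arbitrary: Y rule: finite_induct)
  case empty
  then show ?case by simp
next
  case (insert u E)
  have u: "norm u = 1" and orth: "\<And>e. e \<in> E \<Longrightarrow> u \<bullet> e = 0" and E: "orthonormal E"
    using insert.prems(1) insert.hyps(2)
    by (auto simp: orthonormal_def pairwise_insert orthogonal_def)
  note [measurable] = insert.prems(2) \<open>finite E\<close>
  let ?Y1 = "{x\<in>Y. 0 \<le> u \<bullet> x \<and> u \<bullet> x \<le> w}"
  let ?Y2 = "{x\<in>Y. \<forall>e\<in>E. 0 \<le> e \<bullet> x \<and> e \<bullet> x \<le> 1}"
  have "emeasure lborel {x\<in>Y. \<forall>e\<in>insert u E. 0 \<le> e \<bullet> x \<and> e \<bullet> x \<le> w} =
      emeasure lborel {x\<in>?Y1. \<forall>e\<in>E. 0 \<le> e \<bullet> x \<and> e \<bullet> x \<le> w}"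
    by (rule arg_cong[where f = "emeasure lborel"]) auto
  also have "\<dots> = ennreal (w ^ card E) * emeasure lborel {x\<in>?Y1. \<forall>e\<in>E. 0 \<le> e \<bullet> x \<and> e \<bullet> x \<le> 1}"
    by (rule insert.IH) (use E insert.prems orth in \<open>auto simp: inner_simps\<close>)
  also have "{x\<in>?Y1. \<forall>e\<in>E. 0 \<le> e \<bullet> x \<and> e \<bullet> x \<le> 1} = {x\<in>?Y2. 0 \<le> u \<bullet> x \<and> u \<bullet> x \<le> w}"
    by auto
  also have "emeasure lborel \<dots> = ennreal w * emeasure lborel {x\<in>?Y2. 0 \<le> u \<bullet> x \<and> u \<bullet> x \<le> 1}"
    by (rule emeasure_widen[OF u])
       (use insert.prems orth in \<open>auto simp: inner_simps inner_commute\<close>)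
  also have "{x\<in>?Y2. 0 \<le> u \<bullet> x \<and> u \<bullet> x \<le> 1} = {x\<in>Y. \<forall>e\<in>insert u E. 0 \<le> e \<bullet> x \<and> e \<bullet> x \<le> 1}"
    by auto
  finally show ?case
    using insert.hyps \<open>0 \<le> w\<close> by (simp add: ennreal_mult' mult.assoc[symmetric] ennreal_mult mult.commute)
qed

text \<open>With \<open>w = 1\<close>: the polyhedron \<open>a \<bullet> x \<le> t b\<close>, \<open>(a, b) \<in> K\<close>, inside the ball of squared radius
  \<open>q\<close> of the orthogonal complement of \<open>E\<close>, thickened by the unit cube spanned by \<open>E\<close>.\<close>
definition thick_region :: "'a::euclidean_space set \<Rightarrow> ('a \<times> real) set \<Rightarrow> real \<Rightarrow> real \<Rightarrow> real \<Rightarrow> 'a set" where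
  "thick_region E K w q t = {x. (\<forall>e\<in>E. 0 \<le> e \<bullet> x \<and> e \<bullet> x \<le> w) \<and>
     x \<bullet> x - (\<Sum>e\<in>E. (e \<bullet> x)\<^sup>2) \<le> q \<and> (\<forall>(a, b)\<in>K. a \<bullet> x \<le> t * b)}"

lemma compact_thick_region:
  assumes "finite E"
  shows "compact (thick_region E K w q t)"
proof -
  have "norm x \<le> sqrt (q + (\<Sum>e\<in>E. w\<^sup>2))" if "x \<in> thick_region E K w q t" for x
  proof -
    have "(\<Sum>e\<in>E. (e \<bullet> x)\<^sup>2) \<le> (\<Sum>e\<in>E. w\<^sup>2)"
      using that by (intro sum_mono power_mono) (auto simp: thick_region_def)
    then have "x \<bullet> x \<le> q + (\<Sum>e\<in>E. w\<^sup>2)" using that by (auto simp: thick_region_def)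
    then show ?thesis unfolding norm_eq_sqrt_inner by simp
  qed
  then have "bounded (thick_region E K w q t)" by (auto simp: bounded_iff)
  moreover have "thick_region E K w q t = (\<Inter>e\<in>E. {x. 0 \<le> e \<bullet> x} \<inter> {x. e \<bullet> x \<le> w}) \<inter>
      {x. x \<bullet> x - (\<Sum>e\<in>E. (e \<bullet> x)\<^sup>2) \<le> q} \<inter> (\<Inter>(a, b)\<in>K. {x. a \<bullet> x \<le> t * b})"
    by (auto simp: thick_region_def)
  then have "closed (thick_region E K w q t)"
    by (auto intro!: closed_Int closed_INT closed_Collect_le continuous_intros)
  ultimately show ?thesis by (simp add: compact_eq_bounded_closed)
qed

text \<open>Both sides are squared norms of projections to the orthogonal complement of
  \<open>E\<close>, and this projection kills \<open>e\<close>.\<close>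

lemma norm_complement_orthonormal_translate:
  assumes "orthonormal E" "finite E" "e \<in> E"
  shows "(x + s *\<^sub>R e) \<bullet> (x + s *\<^sub>R e) - (\<Sum>f\<in>E. (f \<bullet> (x + s *\<^sub>R e))\<^sup>2) = x \<bullet> x - (\<Sum>f\<in>E. (f \<bullet> x)\<^sup>2)"
proof -
  have ee: "e \<bullet> e = 1" using assms by (auto simp: orthonormal_def norm_eq_1)
  have fe: "f \<bullet> e = 0" if "f \<in> E - {e}" for f
    using assms that by (auto simp: orthonormal_def pairwise_def orthogonal_def)
  have "(\<Sum>f\<in>E. (f \<bullet> (x + s *\<^sub>R e))\<^sup>2) = (e \<bullet> (x + s *\<^sub>R e))\<^sup>2 + (\<Sum>f\<in>E-{e}. (f \<bullet> (x + s *\<^sub>R e))\<^sup>2)"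
    using assms by (simp add: sum.remove)
  also have "(\<Sum>f\<in>E-{e}. (f \<bullet> (x + s *\<^sub>R e))\<^sup>2) = (\<Sum>f\<in>E-{e}. (f \<bullet> x)\<^sup>2)"
    by (intro sum.cong) (auto simp: inner_simps fe)
  also have "\<dots> = (\<Sum>f\<in>E. (f \<bullet> x)\<^sup>2) - (e \<bullet> x)\<^sup>2"
    using assms by (simp add: sum.remove)
  finally show ?thesis
    by (simp add: inner_simps ee inner_commute power2_eq_square algebra_simps)
qed

text \<open>Dilation by \<open>s\<close> carries radius 1 to radius \<open>s\<close> and the
  parameter \<open>t / s\<close> to \<open>t\<close>, but it is the cube of side
  \<open>1 / s\<close> that it carries to the unit cube. Passing from side 1 to side
  \<open>1 / s\<close> costs the factor \<open>(1 / s) ^ card E\<close>, as all other constraints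
  are invariant along \<open>E\<close>.\<close>

lemma measure_thick_region_scale:
  fixes E :: "'a::euclidean_space set"
  assumes E: "orthonormal E" and K: "\<And>a b e. (a, b) \<in> K \<Longrightarrow> e \<in> E \<Longrightarrow> a \<bullet> e = 0" and "0 < s"
  shows "measure lebesgue (thick_region E K 1 (s\<^sup>2) t) =
         s ^ DIM('a) * (1 / s) ^ card E * measure lebesgue (thick_region E K 1 1 (t / s))"
proof -
  have fin: "finite E" using orthonormal_card_le[OF E] by simp
  have mem: "s *\<^sub>R x \<in> thick_region E K 1 (s\<^sup>2) t \<longleftrightarrow> x \<in> thick_region E K (1/s) 1 (t/s)" for x
  proof -
    have "(s *\<^sub>R x) \<bullet> (s *\<^sub>R x) - (\<Sum>e\<in>E. (e \<bullet> (s *\<^sub>R x))\<^sup>2) = s\<^sup>2 * (x \<bullet> x - (\<Sum>e\<in>E. (e \<bullet> x)\<^sup>2))"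
      by (simp add: power_mult_distrib sum_distrib_left algebra_simps power2_eq_square)
    then have q: "(s *\<^sub>R x) \<bullet> (s *\<^sub>R x) - (\<Sum>e\<in>E. (e \<bullet> (s *\<^sub>R x))\<^sup>2) \<le> s\<^sup>2 \<longleftrightarrow>
        x \<bullet> x - (\<Sum>e\<in>E. (e \<bullet> x)\<^sup>2) \<le> 1" using \<open>0 < s\<close> by simp
    show ?thesis
      using \<open>0 < s\<close> unfolding thick_region_def mem_Collect_eq q
      by (auto simp: field_simps zero_le_mult_iff split: prod.splits)
  qed
  have img: "thick_region E K 1 (s\<^sup>2) t = (\<lambda>x. s *\<^sub>R x + 0) ` thick_region E K (1/s) 1 (t/s)"
  proof (intro equalityI subsetI)
    fix y assume "y \<in> thick_region E K 1 (s\<^sup>2) t"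
    then show "y \<in> (\<lambda>x. s *\<^sub>R x + 0) ` thick_region E K (1/s) 1 (t/s)"
      using mem[of "(1/s) *\<^sub>R y"] \<open>0 < s\<close> by (intro image_eqI[where x = "(1/s) *\<^sub>R y"]) auto
  qed (use mem in auto)
  \<comment> \<open>The region without its cube; the cubes of side \<open>1 / s\<close> and of side
    1 are both cut from this cylinder.\<close>
  define Y where "Y = {x. x \<bullet> x - (\<Sum>e\<in>E. (e \<bullet> x)\<^sup>2) \<le> 1 \<and> (\<forall>(a, b)\<in>K. a \<bullet> x \<le> t / s * b)}"
  have Y: "thick_region E K w 1 (t/s) = {x\<in>Y. \<forall>e\<in>E. 0 \<le> e \<bullet> x \<and> e \<bullet> x \<le> w}" for w
    by (auto simp: thick_region_def Y_def)
  have "Y = {x. x \<bullet> x - (\<Sum>e\<in>E. (e \<bullet> x)\<^sup>2) \<le> 1} \<inter> (\<Inter>(a, b)\<in>K. {x. a \<bullet> x \<le> t / s * b})"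
    by (auto simp: Y_def)
  then have "closed Y"
    by (auto intro!: closed_Int closed_INT closed_Collect_le continuous_intros)
  then have bY: "Y \<in> sets borel" by simp
  have inv: "x + r *\<^sub>R e \<in> Y \<longleftrightarrow> x \<in> Y" if "e \<in> E" for e x r
    unfolding Y_def mem_Collect_eq norm_complement_orthonormal_translate[OF E fin that]
    using K[OF _ that] by (auto simp: inner_simps split: prod.splits)
  have "emeasure lborel (thick_region E K (1/s) 1 (t/s)) =
      ennreal ((1/s) ^ card E) * emeasure lborel (thick_region E K 1 1 (t/s))"
    unfolding Y by (rule emeasure_widen_orthonormal) (use fin E bY \<open>0 < s\<close> inv in auto)
  then have "measure lborel (thick_region E K (1/s) 1 (t/s)) =
      (1/s) ^ card E * measure lborel (thick_region E K 1 1 (t/s))"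
    unfolding measure_def using \<open>0 < s\<close> by (simp add: enn2real_mult)
  then have "measure lebesgue (thick_region E K (1/s) 1 (t/s)) =
      (1/s) ^ card E * measure lebesgue (thick_region E K 1 1 (t/s))"
    by (simp add: borel_compact compact_thick_region fin)
  then show ?thesis
    unfolding img measure_lebesgue_affine using \<open>0 < s\<close> by simp
qed

text \<open>On the hyperplane \<open>u \<bullet> x = s\<close> the component of a normal along
  \<open>u\<close> contributes a multiple of \<open>s\<close>. Homogeneous inequalities thus become
  inequalities \<open>a \<bullet> x \<le> s * b\<close> with \<open>a\<close> orthogonal to
  \<open>u\<close>: the height \<open>s\<close> takes over the role of \<open>t\<close>. The squared
  radius drops by \<open>s^2\<close>, and the thickening puts \<open>u\<close> into
  \<open>E\<close>.\<close>

lemma slice_thick_region: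
  fixes u :: "'a::euclidean_space"
  assumes u: "norm u = 1" and E: "finite E" "\<And>e. e \<in> E \<Longrightarrow> u \<bullet> e = 0"
    and X: "X = {x \<in> thick_region E {} 1 1 0. (\<forall>c\<in>C. c \<bullet> x \<le> 0) \<and> (\<forall>v\<in>A. v \<bullet> x \<le> k * (u \<bullet> x)) \<and>
      \<alpha> \<le> u \<bullet> x \<and> u \<bullet> x \<le> \<beta>}"
    and s: "\<alpha> \<le> s" "s \<le> \<beta>"
  shows "slice u X s = thick_region (insert u E)
     ((\<lambda>v. (v - (u \<bullet> v) *\<^sub>R u, k - u \<bullet> v)) ` A \<union> (\<lambda>c. (c - (u \<bullet> c) *\<^sub>R u, - (u \<bullet> c))) ` C) 1 (1 - s\<^sup>2) s"
proof -
  have uu: "u \<bullet> u = 1" using u by (simp add: norm_eq_1)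
  have "u \<notin> E" using E uu by force
  have eu: "e \<bullet> u = 0" if "e \<in> E" for e using E that by (simp add: inner_commute)
  have inner: "v \<bullet> (x - (u \<bullet> x) *\<^sub>R u + s *\<^sub>R u) = (v - (u \<bullet> v) *\<^sub>R u) \<bullet> x + s * (u \<bullet> v)" for v x
    by (simp add: inner_simps inner_commute)
  have e: "e \<bullet> (x - (u \<bullet> x) *\<^sub>R u + s *\<^sub>R u) = e \<bullet> x" if "e \<in> E" for e x
    using eu[OF that] by (simp add: inner_simps)
  have ux: "u \<bullet> (x - (u \<bullet> x) *\<^sub>R u + s *\<^sub>R u) = s" for x by (simp add: inner_simps uu)
  have sq: "(x - (u \<bullet> x) *\<^sub>R u + s *\<^sub>R u) \<bullet> (x - (u \<bullet> x) *\<^sub>R u + s *\<^sub>R u) = x \<bullet> x - (u \<bullet> x)\<^sup>2 + s\<^sup>2" for x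
    by (simp add: inner_simps uu inner_commute power2_eq_square algebra_simps)
  have sum: "(\<Sum>e\<in>E. (e \<bullet> (x - (u \<bullet> x) *\<^sub>R u + s *\<^sub>R u))\<^sup>2) = (\<Sum>e\<in>E. (e \<bullet> x)\<^sup>2)" for x
    by (intro sum.cong) (auto simp: e)
  have mem: "x - (u \<bullet> x) *\<^sub>R u + s *\<^sub>R u \<in> X \<longleftrightarrow> (\<forall>e\<in>E. 0 \<le> e \<bullet> x \<and> e \<bullet> x \<le> 1) \<and>
      x \<bullet> x - (\<Sum>e\<in>insert u E. (e \<bullet> x)\<^sup>2) \<le> 1 - s\<^sup>2 \<and>
      (\<forall>c\<in>C. (c - (u \<bullet> c) *\<^sub>R u) \<bullet> x \<le> s * - (u \<bullet> c)) \<and>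
      (\<forall>v\<in>A. (v - (u \<bullet> v) *\<^sub>R u) \<bullet> x \<le> s * (k - u \<bullet> v))" for x
  proof -
    have 1: "x \<bullet> x - (u \<bullet> x)\<^sup>2 + s\<^sup>2 - (\<Sum>e\<in>E. (e \<bullet> x)\<^sup>2) \<le> 1 \<longleftrightarrow>
       x \<bullet> x - (\<Sum>e\<in>insert u E. (e \<bullet> x)\<^sup>2) \<le> 1 - s\<^sup>2"
      using \<open>finite E\<close> \<open>u \<notin> E\<close> by auto
    have 2: "y + s * (u \<bullet> v) \<le> k * s \<longleftrightarrow> y \<le> s * (k - u \<bullet> v)"
      "y + s * (u \<bullet> v) \<le> 0 \<longleftrightarrow> y \<le> s * - (u \<bullet> v)" for y v
      by (auto simp: algebra_simps)
    have 3: "(\<forall>e\<in>E. 0 \<le> e \<bullet> (x - (u \<bullet> x) *\<^sub>R u + s *\<^sub>R u) \<and> e \<bullet> (x - (u \<bullet> x) *\<^sub>R u + s *\<^sub>R u) \<le> 1)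
       \<longleftrightarrow> (\<forall>e\<in>E. 0 \<le> e \<bullet> x \<and> e \<bullet> x \<le> 1)"
      using e by simp
    show ?thesis
      unfolding X thick_region_def mem_Collect_eq
      unfolding ux sq sum 3
      unfolding inner 1 2
      using s by blast
  qed
  show ?thesis
    unfolding slice_def mem
    unfolding thick_region_def by (simp add: ball_Un) blast
qed

section \<open>Induction on the dimension\<close>

text \<open>The inequalities from \<open>C\<close> do not move with \<open>t\<close>, those from
  \<open>A\<close> relax. What is gained between \<open>t1\<close> and \<open>t2\<close> splits, up
  to null sets, according to the normal in \<open>A\<close> with the largest inner product, and each
  part is a slab whose slices fall under \<open>IH\<close>. So the volume is a constant plus a sum
  of primitives.\<close>

lemma right_analytic_measure_thick_region_normalized:
  fixes E :: "'a::euclidean_space set"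
  assumes E: "orthonormal E" and fin: "finite A" "finite C" and "0 \<notin> A"
    and orth: "\<And>v e. v \<in> A \<union> C \<Longrightarrow> e \<in> E \<Longrightarrow> v \<bullet> e = 0"
    and IH: "\<And>u K. norm u = 1 \<Longrightarrow> (\<And>e. e \<in> E \<Longrightarrow> u \<bullet> e = 0) \<Longrightarrow> finite K \<Longrightarrow>
       (\<And>v b e. (v, b) \<in> K \<Longrightarrow> e \<in> insert u E \<Longrightarrow> v \<bullet> e = 0) \<Longrightarrow>
       right_analytic (\<lambda>t. measure lebesgue (thick_region (insert u E) K 1 1 t))"
  shows "right_analytic (\<lambda>t. measure lebesgue (thick_region E (A \<times> {1} \<union> C \<times> {0}) 1 1 t))"
proof -
  have finE: "finite E" using orthonormal_card_le[OF E] by simp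
  \<comment> \<open>Where \<open>a\<close> dominates \<open>A\<close>, only
    \<open>a \<bullet> x\<close> has to be compared with \<open>t1\<close> and \<open>t2\<close>;
    the other conditions are homogeneous, as slicing requires.\<close>
  define M where "M a t1 t2 = {x \<in> thick_region E {} 1 1 0. (\<forall>c\<in>C. c \<bullet> x \<le> 0) \<and>
     (\<forall>v\<in>A. v \<bullet> x \<le> a \<bullet> x) \<and> t1 \<le> a \<bullet> x \<and> a \<bullet> x \<le> t2}" for a t1 t2
  have compM: "compact (M a t1 t2)" for a t1 t2
  proof -
    have "M a t1 t2 = thick_region E {} 1 1 0 \<inter> ((\<Inter>c\<in>C. {x. c \<bullet> x \<le> 0}) \<inter> (\<Inter>v\<in>A. {x. v \<bullet> x \<le> a \<bullet> x}) \<inter>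
       {x. t1 \<le> a \<bullet> x} \<inter> {x. a \<bullet> x \<le> t2})"
      by (auto simp: M_def)
    then show ?thesis
      by (auto intro!: compact_Int_closed compact_thick_region finE closed_Int closed_INT
            closed_Collect_le continuous_intros)
  qed
  define R where "R t = thick_region E (A \<times> {1} \<union> C \<times> {0}) 1 1 t" for t
  have R: "x \<in> R t \<longleftrightarrow> x \<in> thick_region E {} 1 1 0 \<and> (\<forall>c\<in>C. c \<bullet> x \<le> 0) \<and> (\<forall>v\<in>A. v \<bullet> x \<le> t)" for x t
  proof -
    have prod: "(\<forall>(a, b)\<in>B \<times> {k}. a \<bullet> x \<le> t * b) \<longleftrightarrow> (\<forall>a\<in>B. a \<bullet> x \<le> t * k)" for B k
      by auto
    have "(\<forall>(a, b)\<in>A \<times> {1} \<union> C \<times> {0}. a \<bullet> x \<le> t * b) \<longleftrightarrow> (\<forall>c\<in>C. c \<bullet> x \<le> 0) \<and> (\<forall>v\<in>A. v \<bullet> x \<le> t)"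
      by (simp add: ball_Un prod) blast
    then show ?thesis unfolding R_def thick_region_def by auto
  qed
  have compR: "compact (R t)" for t unfolding R_def by (intro compact_thick_region finE)
  have "\<exists>F \<epsilon>. right_analytic F \<and> \<epsilon> > 0 \<and>
    (\<forall>t1 t2. 0 < t1 \<longrightarrow> t1 \<le> t2 \<longrightarrow> t2 < \<epsilon> \<longrightarrow> measure lebesgue (M a t1 t2) = F t2 - F t1)"
    if a: "a \<in> A" for a
  proof -
    define u where "u = a /\<^sub>R norm a"
    have na: "norm a > 0" using a \<open>0 \<notin> A\<close> by auto
    have u: "norm u = 1" using na by (simp add: u_def)
    have au: "a = norm a *\<^sub>R u" using na by (simp add: u_def)
    have ax: "a \<bullet> x = norm a * (u \<bullet> x)" for x by (subst au) simp
    have uE: "u \<bullet> e = 0" if "e \<in> E" for e using orth[of a e] a that by (simp add: u_def)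
    \<comment> \<open>The constraints of the slices, from \<open>slice_thick_region\<close> with
      \<open>k = norm a\<close>, since
      \<open>a \<bullet> x = norm a * (u \<bullet> x)\<close>.\<close>
    define K where "K = (\<lambda>v. (v - (u \<bullet> v) *\<^sub>R u, norm a - u \<bullet> v)) ` A \<union>
      (\<lambda>c. (c - (u \<bullet> c) *\<^sub>R u, - (u \<bullet> c))) ` C"
    have uu: "u \<bullet> u = 1" using u by (simp add: norm_eq_1)
    have orth': "(v - (u \<bullet> v) *\<^sub>R u) \<bullet> e = 0" if "v \<in> A \<union> C" "e \<in> insert u E" for v e
    proof (cases "e = u")
      case True
      then show ?thesis by (simp add: inner_diff_left uu inner_commute[of v u])
    next
      case False
      then show ?thesis using orth[of v e] uE[of e] that by (simp add: inner_diff_left)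
    qed
    have K: "finite K" "\<And>v b e. (v, b) \<in> K \<Longrightarrow> e \<in> insert u E \<Longrightarrow> v \<bullet> e = 0"
      unfolding K_def using fin by (auto intro!: orth')
    have uE': "orthonormal (insert u E)" using orthonormal_insert(1)[OF E u uE] by simp
    define f where "f s = measure lebesgue (thick_region (insert u E) K 1 (1 - s\<^sup>2) s)" for s
    have "right_analytic f"
    \<comment> \<open>\<open>IH\<close> speaks of the unit ball; rescaling the ball of radius
      \<open>sqrt (1 - s^2)\<close> changes the parameter \<open>s\<close> into
      \<open>s / sqrt (1 - s^2)\<close>.\<close>
    proof (rule right_analytic_cong[OF right_analytic_sqrt_substitution[OF IH[OF u uE K]]])
      fix s :: real assume s: "0 < s" "s < 1"
      have p: "0 < 1 - s\<^sup>2" using s by (simp add: power_less_one_iff)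
      have q: "0 < sqrt (1 - s\<^sup>2)" "(sqrt (1 - s\<^sup>2))\<^sup>2 = 1 - s\<^sup>2" using p by auto
      have "measure lebesgue (thick_region (insert u E) K 1 ((sqrt (1 - s\<^sup>2))\<^sup>2) s) =
          sqrt (1 - s\<^sup>2) ^ DIM('a) * (1 / sqrt (1 - s\<^sup>2)) ^ card (insert u E) *
          measure lebesgue (thick_region (insert u E) K 1 1 (s / sqrt (1 - s\<^sup>2)))"
        by (rule measure_thick_region_scale[OF uE' _ q(1)], erule (1) K(2))
      then show "f s = sqrt (1 - s\<^sup>2) ^ DIM('a) * (1 / sqrt (1 - s\<^sup>2)) ^ card (insert u E) *
          measure lebesgue (thick_region (insert u E) K 1 1 (s / sqrt (1 - s\<^sup>2)))"
        unfolding f_def by (simp only: q(2))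
    qed simp_all
    then obtain \<epsilon> F where F: "\<epsilon> > 0" "right_analytic F"
      "\<And>t. 0 < t \<Longrightarrow> t < \<epsilon> \<Longrightarrow> (F has_real_derivative f t) (at t)"
      using right_analytic_primitive by blast
    have "measure lebesgue (M a t1 t2) = F (t2 / norm a) - F (t1 / norm a)"
      if "0 < t1" "t1 \<le> t2" "t2 < \<epsilon> * norm a" for t1 t2
    proof (rule measure_slab[OF u compM, where \<Phi> = F and \<alpha> = "t1 / norm a" and \<beta> = "t2 / norm a"])
      have M: "M a t1 t2 = {x \<in> thick_region E {} 1 1 0. (\<forall>c\<in>C. c \<bullet> x \<le> 0) \<and> (\<forall>v\<in>A. v \<bullet> x \<le> norm a * (u \<bullet> x)) \<and>
        t1 / norm a \<le> u \<bullet> x \<and> u \<bullet> x \<le> t2 / norm a}"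
        using na unfolding M_def ax by (auto simp: field_simps)
      show "t1 / norm a \<le> u \<bullet> x \<and> u \<bullet> x \<le> t2 / norm a" if "x \<in> M a t1 t2" for x
        using that unfolding M by auto
      show "t1 / norm a \<le> t2 / norm a" using that na by (simp add: divide_right_mono)
      show "(F has_real_derivative measure lebesgue (slice u (M a t1 t2) s)) (at s)"
        if s: "t1 / norm a \<le> s" "s \<le> t2 / norm a" for s
      proof -
        have "0 < t1 / norm a" "t2 / norm a < \<epsilon>"
          using \<open>0 < t1\<close> \<open>t2 < \<epsilon> * norm a\<close> na by (auto simp: field_simps)
        then have "0 < s" "s < \<epsilon>" using s by linarith+
        then show ?thesis
          using F(3)[of s] slice_thick_region[OF u finE uE M s] by (simp add: f_def K_def)
      qed
    qed
    moreover have "right_analytic (\<lambda>t. F (t / norm a))"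
      using right_analytic_dilate[OF F(2) na] .
    moreover have "\<epsilon> * norm a > 0" using F(1) na by simp
    ultimately show ?thesis by blast
  qed
  then obtain F \<epsilon> where F: "\<And>a. a \<in> A \<Longrightarrow> right_analytic (F a)" "\<And>a. a \<in> A \<Longrightarrow> \<epsilon> a > 0"
    "\<And>a t1 t2. a \<in> A \<Longrightarrow> 0 < t1 \<Longrightarrow> t1 \<le> t2 \<Longrightarrow> t2 < \<epsilon> a \<Longrightarrow> measure lebesgue (M a t1 t2) = F a t2 - F a t1"
    by metis
  have step: "measure lebesgue (R t2) = measure lebesgue (R t1) + (\<Sum>a\<in>A. measure lebesgue (M a t1 t2))"
    if "0 < t1" "t1 \<le> t2" for t1 t2
  proof -
    have U: "R t2 = R t1 \<union> (\<Union>a\<in>A. M a t1 t2)"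
    proof (intro equalityI subsetI)
      fix x assume x: "x \<in> R t2"
      show "x \<in> R t1 \<union> (\<Union>a\<in>A. M a t1 t2)"
      proof (cases "\<forall>v\<in>A. v \<bullet> x \<le> t1")
        case True
        then show ?thesis using x by (auto simp: R)
      next
        case False
        then obtain v where v: "v \<in> A" "t1 < v \<bullet> x" by force
        obtain a where a: "a \<in> A" "\<And>v. v \<in> A \<Longrightarrow> v \<bullet> x \<le> a \<bullet> x"
          using obtains_MAX[OF \<open>finite A\<close>, of "\<lambda>v. v \<bullet> x"] v(1) \<open>finite A\<close>
          by (metis Max_ge empty_iff finite_imageI imageI)
        have "t1 \<le> a \<bullet> x" using a(2)[OF v(1)] v(2) by linarith
        then have "x \<in> M a t1 t2" using a x by (auto simp: M_def R)
        then show ?thesis using a by auto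
      qed
    next
      fix x assume "x \<in> R t1 \<union> (\<Union>a\<in>A. M a t1 t2)"
      then show "x \<in> R t2" using \<open>t1 \<le> t2\<close> by (fastforce simp: M_def R)
    qed
    \<comment> \<open>For \<open>a = 0\<close> the set is empty because
      \<open>t1 > 0\<close>.\<close>
    have hyp: "negligible {x. a \<bullet> x = t1}" for a :: 'a
      using \<open>0 < t1\<close> by (intro negligible_hyperplane) auto
    have n1: "negligible (R t1 \<inter> (\<Union>a\<in>A. M a t1 t2))"
    proof (rule negligible_subset)
      show "negligible (\<Union>a\<in>A. {x. a \<bullet> x = t1})" using fin hyp by (intro negligible_Union) auto
      show "R t1 \<inter> (\<Union>a\<in>A. M a t1 t2) \<subseteq> (\<Union>a\<in>A. {x. a \<bullet> x = t1})"
        by (force simp: R M_def)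
    qed
    have n2: "pairwise (\<lambda>a a'. negligible (M a t1 t2 \<inter> M a' t1 t2)) A"
    proof (rule pairwiseI)
      fix a a' assume "a \<in> A" "a' \<in> A" "a \<noteq> a'"
      show "negligible (M a t1 t2 \<inter> M a' t1 t2)"
      proof (rule negligible_subset)
        show "negligible {x. (a - a') \<bullet> x = 0}" using \<open>a \<noteq> a'\<close> by (intro negligible_hyperplane) auto
        show "M a t1 t2 \<inter> M a' t1 t2 \<subseteq> {x. (a - a') \<bullet> x = 0}"
          using \<open>a \<in> A\<close> \<open>a' \<in> A\<close> by (force simp: M_def inner_simps)
      qed
    qed
    have lm: "R t1 \<in> lmeasurable" "\<And>a. M a t1 t2 \<in> lmeasurable"
      using compR compM by (auto intro: lmeasurable_compact)
    have lU: "(\<Union>a\<in>A. M a t1 t2) \<in> lmeasurable" using lm fin by (intro fmeasurable.finite_UN) auto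
    have "measure lebesgue (R t2) = measure lebesgue (R t1) + measure lebesgue (\<Union>a\<in>A. M a t1 t2)"
      unfolding U using lm lU n1 by (simp add: measure_Un3 negligible_imp_measure0)
    also have "measure lebesgue (\<Union>a\<in>A. M a t1 t2) = (\<Sum>a\<in>A. measure lebesgue (M a t1 t2))"
      using fin lm n2 by (intro measure_negligible_finite_Union_image) auto
    finally show ?thesis .
  qed
  \<comment> \<open>The element 1 keeps the minimum meaningful for empty \<open>A\<close>.\<close>
  define \<delta> where "\<delta> = Min (insert 1 (\<epsilon> ` A))"
  have \<delta>: "\<delta> > 0" "\<And>a. a \<in> A \<Longrightarrow> \<delta> \<le> \<epsilon> a" using fin F(2) by (auto simp: \<delta>_def)
  have diff: "measure lebesgue (R t2) - (\<Sum>a\<in>A. F a t2) = measure lebesgue (R t1) - (\<Sum>a\<in>A. F a t1)"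
    if "0 < t1" "t1 \<le> t2" "t2 < \<delta>" for t1 t2
  proof -
    have "(\<Sum>a\<in>A. measure lebesgue (M a t1 t2)) = (\<Sum>a\<in>A. F a t2 - F a t1)"
      using that \<delta> by (intro sum.cong F(3)) (auto intro: less_le_trans)
    then show ?thesis using step[OF that(1,2)] by (simp add: sum_subtractf)
  qed
  \<comment> \<open>By \<open>diff\<close>, volume minus primitives is constant for
    \<open>0 < t < \<delta>\<close>. It is read off at an interior point, since nothing is known
    about the primitives at 0.\<close>
  define c where "c = measure lebesgue (R (\<delta>/2)) - (\<Sum>a\<in>A. F a (\<delta>/2))"
  have "right_analytic (\<lambda>t. measure lebesgue (R t))"
  proof (rule right_analytic_cong[OF _ \<open>\<delta> > 0\<close>])
    show "right_analytic (\<lambda>t. c + (\<Sum>a\<in>A. F a t))"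
      using F fin by (intro right_analytic_add right_analytic_const right_analytic_sum) auto
    fix t assume t: "0 < t" "t < \<delta>"
    show "measure lebesgue (R t) = c + (\<Sum>a\<in>A. F a t)"
      using diff[of t "\<delta>/2"] diff[of "\<delta>/2" t] t \<delta>(1) unfolding c_def
      by (cases "t \<le> \<delta>/2") auto
  qed
  then show ?thesis unfolding R_def .
qed

lemma thick_region_insert:
  "thick_region E (insert (a, b) K) w q t = {x \<in> thick_region E K w q t. a \<bullet> x \<le> t * b}"
  by (auto simp: thick_region_def)

text \<open>Reduction to right-hand sides 0 and 1: a positive \<open>b\<close> is divided out, a
  negative one is handled by complementation, and inequalities with \<open>a = 0\<close> are always
  true or always false for \<open>t > 0\<close>.\<close>

lemma right_analytic_measure_thick_region_step:
  fixes E :: "'a::euclidean_space set"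
  assumes E: "orthonormal E" and fin: "finite K"
    and orth: "\<And>v b e. (v, b) \<in> K \<Longrightarrow> e \<in> E \<Longrightarrow> v \<bullet> e = 0"
    and IH: "\<And>u K. norm u = 1 \<Longrightarrow> (\<And>e. e \<in> E \<Longrightarrow> u \<bullet> e = 0) \<Longrightarrow> finite K \<Longrightarrow>
       (\<And>v b e. (v, b) \<in> K \<Longrightarrow> e \<in> insert u E \<Longrightarrow> v \<bullet> e = 0) \<Longrightarrow>
       right_analytic (\<lambda>t. measure lebesgue (thick_region (insert u E) K 1 1 t))"
  shows "right_analytic (\<lambda>t. measure lebesgue (thick_region E K 1 1 t))"
proof -
  have finE: "finite E" using orthonormal_card_le[OF E] by simp
  \<comment> \<open>Strengthened for the induction on \<open>K\<close>: \<open>A\<close> and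
    \<open>C\<close> collect the inequalities already normalised to \<open>b = 1\<close> and
    \<open>b = 0\<close>, and grow along the way.\<close>
  have "right_analytic (\<lambda>t. measure lebesgue (thick_region E (K \<union> (A \<times> {1} \<union> C \<times> {0})) 1 1 t))"
    if "finite A" "finite C" "0 \<notin> A" "\<And>v e. v \<in> A \<union> C \<Longrightarrow> e \<in> E \<Longrightarrow> v \<bullet> e = 0" for A C
    using fin orth that
  proof (induction K arbitrary: A C rule: finite_induct)
    case empty
    have "right_analytic (\<lambda>t. measure lebesgue (thick_region E (A \<times> {1} \<union> C \<times> {0}) 1 1 t))"
    proof (rule right_analytic_measure_thick_region_normalized[OF E empty.prems(2,3,4)])
      show "v \<bullet> e = 0" if "v \<in> A \<union> C" "e \<in> E" for v e using empty.prems(5) that by blast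
    qed (rule IH)
    then show ?case by simp
  next
    case (insert k K)
    obtain a b where k: "k = (a, b)" by force
    define L where "L = K \<union> (A \<times> {1} \<union> C \<times> {0})"
    have L: "insert k K \<union> (A \<times> {1} \<union> C \<times> {0}) = insert (a, b) L" by (simp add: L_def k)
    have orthK: "v \<bullet> e = 0" if "(v, c) \<in> K" "e \<in> E" for v c e
      using insert.prems(1) that by blast
    have ae: "a \<bullet> e = 0" if "e \<in> E" for e using insert.prems(1)[of a b e] that k by simp
    have RL: "right_analytic (\<lambda>t. measure lebesgue (thick_region E L 1 1 t))"
      unfolding L_def by (rule insert.IH[OF orthK]) (use insert.prems in auto)
    have RA: "right_analytic (\<lambda>t. measure lebesgue (thick_region E (insert (a /\<^sub>R b, 1) L) 1 1 t))"
      if "a \<noteq> 0" "b \<noteq> 0"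
    proof -
      have eq: "insert (a /\<^sub>R b, 1) L = K \<union> (insert (a /\<^sub>R b) A \<times> {1} \<union> C \<times> {0})"
        by (auto simp: L_def)
      show ?thesis
        unfolding eq by (rule insert.IH[OF orthK]) (use insert.prems that ae in auto)
    qed
    consider "a = 0" "b \<ge> 0" | "a = 0" "b < 0" | "a \<noteq> 0" "b > 0" | "a \<noteq> 0" "b = 0" | "a \<noteq> 0" "b < 0"
      by linarith
    then show ?case
    proof cases
      case 1
      then show ?thesis
        unfolding L by (intro right_analytic_cong[OF RL, where \<delta> = 1]) (auto simp: thick_region_insert)
    next
      case 2
      have "thick_region E (insert (a, b) L) 1 1 t = {}" if "0 < t" for t
        using 2 that by (auto simp: thick_region_insert not_le mult_pos_neg)
      then show ?thesis
        unfolding L by (intro right_analytic_cong[OF right_analytic_const[of 0], where \<delta> = 1]) auto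
    next
      case 3
      then have "thick_region E (insert (a, b) L) 1 1 t = thick_region E (insert (a /\<^sub>R b, 1) L) 1 1 t" for t
        by (auto simp: thick_region_insert field_simps)
      then show ?thesis unfolding L using RA 3 by simp
    next
      case 4
      have eq: "insert (a, b) L = K \<union> (A \<times> {1} \<union> insert a C \<times> {0})"
        using 4 by (auto simp: L_def)
      show ?thesis
        unfolding L eq by (rule insert.IH[OF orthK]) (use insert.prems ae in auto)
    next
      case 5
      \<comment> \<open>Up to a null set, this half-space is the complement of one with \<open>b = 1\<close>.\<close>
      show ?thesis
        unfolding L
      proof (rule right_analytic_cong[OF right_analytic_diff[OF RL RA[OF 5(1)]], where \<delta> = 1])
        fix t :: real
        let ?G = "\<lambda>K. thick_region E K 1 1 t"
        have le: "(a /\<^sub>R b) \<bullet> x \<le> t * 1 \<longleftrightarrow> t * b \<le> a \<bullet> x" for x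
          using 5(2) by (simp add: field_simps)
        have ins: "?G (insert (a /\<^sub>R b, 1) L) = {x \<in> ?G L. t * b \<le> a \<bullet> x}"
          unfolding thick_region_insert le ..
        have U: "?G L = ?G (insert (a, b) L) \<union> ?G (insert (a /\<^sub>R b, 1) L)"
          unfolding ins thick_region_insert[of E a b] by auto
        have I: "?G (insert (a, b) L) \<inter> ?G (insert (a /\<^sub>R b, 1) L) \<subseteq> {x. a \<bullet> x = t * b}"
          unfolding ins thick_region_insert[of E a b] by auto
        have "negligible (?G (insert (a, b) L) \<inter> ?G (insert (a /\<^sub>R b, 1) L))"
          by (rule negligible_subset[OF negligible_hyperplane I]) (use 5 in auto)
        then have "measure lebesgue (?G L) =
            measure lebesgue (?G (insert (a, b) L)) + measure lebesgue (?G (insert (a /\<^sub>R b, 1) L))"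
          unfolding U
          by (simp add: measure_Un3 negligible_imp_measure0 lmeasurable_compact compact_thick_region finE)
        then show "measure lebesgue (?G (insert (a, b) L)) =
            measure lebesgue (?G L) - measure lebesgue (?G (insert (a /\<^sub>R b, 1) L))" by simp
      qed (use 5 in auto)
    qed
  qed
  from this[of "{}" "{}"] show ?thesis by simp
qed

text \<open>Induction on the codimension of the span of \<open>E\<close>. It starts by itself: if
  \<open>E\<close> spans the space, no unit vector is orthogonal to it and the premise of the step
  about \<open>u\<close> is vacuous. Otherwise \<open>insert u E\<close> is still orthonormal, so
  its cardinality is at most the dimension and the natural subtraction really decreases.\<close>

lemma right_analytic_measure_thick_region:
  fixes E :: "'a::euclidean_space set"
  assumes "orthonormal E" "finite K" "\<And>v b e. (v, b) \<in> K \<Longrightarrow> e \<in> E \<Longrightarrow> v \<bullet> e = 0"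
  shows "right_analytic (\<lambda>t. measure lebesgue (thick_region E K 1 1 t))"
  using assms
proof (induction "DIM('a) - card E" arbitrary: E K rule: less_induct)
  case less
  show ?case
  proof (rule right_analytic_measure_thick_region_step[OF less.prems])
    fix u :: 'a and K' :: "('a \<times> real) set"
    assume u: "norm u = 1" "\<And>e. e \<in> E \<Longrightarrow> u \<bullet> e = 0" and K': "finite K'"
      "\<And>v b e. (v, b) \<in> K' \<Longrightarrow> e \<in> insert u E \<Longrightarrow> v \<bullet> e = 0"
    note o = orthonormal_insert[OF less.prems(1) u]
    have "DIM('a) - card (insert u E) < DIM('a) - card E"
      using orthonormal_card_le[OF o(1)] orthonormal_card_le(1)[OF less.prems(1)] o(2) by simp
    then show "right_analytic (\<lambda>t. measure lebesgue (thick_region (insert u E) K' 1 1 t))"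
      by (rule less.hyps[OF _ o(1) K'])
  qed
qed

section \<open>Voronoi pieces\<close>

text \<open>The part of the ball around \<open>q\<close> on which \<open>q\<close> is a farthest (\<open>\<sigma> = 1\<close>) or a nearest (\<open>\<sigma> = -1\<close>)
  point of \<open>S\<close>.\<close>
definition piece :: "real \<Rightarrow> 'a::euclidean_space set \<Rightarrow> 'a \<Rightarrow> real \<Rightarrow> 'a set" where
  "piece \<sigma> S q r = {x \<in> cball q r. \<forall>q'\<in>S. \<sigma> * (dist x q')\<^sup>2 \<le> \<sigma> * (dist x q)\<^sup>2}"

lemma inner_add_self: "(y + z) \<bullet> (y + z) = y \<bullet> y + 2 * (z \<bullet> y) + z \<bullet> z" for y z :: "'a::real_inner"
  by (simp add: inner_simps inner_commute)

text \<open>Substitute \<open>x = r *\<^sub>R y + q\<close>. In the comparison of two squared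
  distances the quadratic terms in \<open>y\<close> cancel, and dividing the remaining linear
  inequality by \<open>r\<close> leaves a right-hand side proportional to \<open>1 / r\<close>, the
  future \<open>t\<close>.\<close>

lemma piece_eq_image:
  fixes q :: "'a::euclidean_space"
  assumes "0 < r"
  shows "piece \<sigma> S q r = (\<lambda>y. r *\<^sub>R y + q) `
    thick_region {} ((\<lambda>q'. ((2 * \<sigma>) *\<^sub>R (q - q'), - \<sigma> * (dist q q')\<^sup>2)) ` S) 1 1 (1 / r)"
    (is "_ = ?g ` ?G")
proof -
  have mem: "r *\<^sub>R y + q \<in> piece \<sigma> S q r \<longleftrightarrow> y \<in> ?G" for y
  proof -
    have 1: "r *\<^sub>R y + q \<in> cball q r \<longleftrightarrow> y \<bullet> y \<le> 1"
      using assms norm_le_square[of y 1] by (simp add: dist_norm)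
    have "\<sigma> * (dist (r *\<^sub>R y + q) q')\<^sup>2 \<le> \<sigma> * (dist (r *\<^sub>R y + q) q)\<^sup>2 \<longleftrightarrow>
       ((2 * \<sigma>) *\<^sub>R (q - q')) \<bullet> y \<le> 1 / r * (- \<sigma> * (dist q q')\<^sup>2)" for q'
    proof -
      have d: "(dist (r *\<^sub>R y + q) q')\<^sup>2 = (dist (r *\<^sub>R y + q) q)\<^sup>2 + 2 * r * ((q - q') \<bullet> y) + (dist q q')\<^sup>2"
        unfolding dist_norm power2_norm_eq_inner
        using inner_add_self[of "r *\<^sub>R y" "q - q'"] by (simp add: add_diff_eq)
      have "\<sigma> * (dist (r *\<^sub>R y + q) q')\<^sup>2 = \<sigma> * (dist (r *\<^sub>R y + q) q)\<^sup>2 +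
          r * (2 * \<sigma> * ((q - q') \<bullet> y)) + \<sigma> * (dist q q')\<^sup>2"
        unfolding d by algebra
      then have "\<sigma> * (dist (r *\<^sub>R y + q) q')\<^sup>2 \<le> \<sigma> * (dist (r *\<^sub>R y + q) q)\<^sup>2 \<longleftrightarrow>
          r * (2 * \<sigma> * ((q - q') \<bullet> y)) \<le> - \<sigma> * (dist q q')\<^sup>2"
        by linarith
      also have "\<dots> \<longleftrightarrow> 2 * \<sigma> * ((q - q') \<bullet> y) \<le> 1 / r * (- \<sigma> * (dist q q')\<^sup>2)"
        using assms by (simp add: field_simps)
      finally show ?thesis by simp
    qed
    then show ?thesis
      unfolding piece_def thick_region_def mem_Collect_eq 1 by auto
  qed
  show ?thesis
  proof (intro equalityI subsetI)
    fix x assume "x \<in> piece \<sigma> S q r"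
    then show "x \<in> ?g ` ?G"
      using mem[of "(x - q) /\<^sub>R r"] assms by (intro image_eqI[where x = "(x - q) /\<^sub>R r"]) auto
  qed (use mem in auto)
qed

text \<open>A point in two pieces is equidistant from two distinct centres, so it lies on their
  bisecting hyperplane; overlaps are null sets and volumes add.\<close>

lemma measure_Union_piece:
  fixes S :: "'a::euclidean_space set"
  assumes "finite S" "\<sigma> \<noteq> 0" "0 < r"
  shows "measure lebesgue (\<Union>q\<in>S. piece \<sigma> S q r) = r ^ DIM('a) * (\<Sum>q\<in>S. measure lebesgue
    (thick_region {} ((\<lambda>q'. ((2 * \<sigma>) *\<^sub>R (q - q'), - \<sigma> * (dist q q')\<^sup>2)) ` S) 1 1 (1 / r)))"
proof -
  have "pairwise (\<lambda>q q'. negligible (piece \<sigma> S q r \<inter> piece \<sigma> S q' r)) S"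
  proof (rule pairwiseI)
    fix q q' assume q: "q \<in> S" "q' \<in> S" "q \<noteq> q'"
    have "piece \<sigma> S q r \<inter> piece \<sigma> S q' r \<subseteq> {x. (2 *\<^sub>R (q' - q)) \<bullet> x = q' \<bullet> q' - q \<bullet> q}"
    proof
      fix x assume "x \<in> piece \<sigma> S q r \<inter> piece \<sigma> S q' r"
      then have "\<sigma> * (dist x q')\<^sup>2 = \<sigma> * (dist x q)\<^sup>2" using q by (force simp: piece_def)
      then have "(dist x q')\<^sup>2 = (dist x q)\<^sup>2" using \<open>\<sigma> \<noteq> 0\<close> by simp
      then show "x \<in> {x. (2 *\<^sub>R (q' - q)) \<bullet> x = q' \<bullet> q' - q \<bullet> q}"
        unfolding dist_norm power2_norm_eq_inner by (simp add: inner_simps inner_commute algebra_simps)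
    qed
    then show "negligible (piece \<sigma> S q r \<inter> piece \<sigma> S q' r)"
      by (rule negligible_subset[OF negligible_hyperplane, rotated]) (use q in simp)
  qed
  moreover have "compact (piece \<sigma> S q r)" for q
    unfolding piece_eq_image[OF \<open>0 < r\<close>]
    by (intro compact_continuous_image compact_thick_region continuous_intros) simp
  ultimately have "measure lebesgue (\<Union>q\<in>S. piece \<sigma> S q r) = (\<Sum>q\<in>S. measure lebesgue (piece \<sigma> S q r))"
    using \<open>finite S\<close> by (intro measure_negligible_finite_Union_image) (auto intro: lmeasurable_compact)
  also have "\<dots> = r ^ DIM('a) * (\<Sum>q\<in>S. measure lebesgue
    (thick_region {} ((\<lambda>q'. ((2 * \<sigma>) *\<^sub>R (q - q'), - \<sigma> * (dist q q')\<^sup>2)) ` S) 1 1 (1 / r)))"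
    unfolding piece_eq_image[OF \<open>0 < r\<close>] measure_lebesgue_affine
    using \<open>0 < r\<close> by (simp add: sum_distrib_left)
  finally show ?thesis .
qed

lemma measure_Union_piece_right_analytic:
  fixes S :: "'a::euclidean_space set"
  assumes "finite S" "\<sigma> \<noteq> 0"
  obtains W where "right_analytic W"
    "\<And>r. 0 < r \<Longrightarrow> measure lebesgue (\<Union>q\<in>S. piece \<sigma> S q r) = r ^ DIM('a) * W (1 / r)"
proof
  show "right_analytic (\<lambda>t. \<Sum>q\<in>S. measure lebesgue
    (thick_region {} ((\<lambda>q'. ((2 * \<sigma>) *\<^sub>R (q - q'), - \<sigma> * (dist q q')\<^sup>2)) ` S) 1 1 t))"
    using assms by (intro right_analytic_sum right_analytic_measure_thick_region)
      (auto simp: orthonormal_def)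
qed (rule measure_Union_piece[OF assms])

text \<open>A point lies in all balls as soon as it lies in the ball around its farthest
  centre.\<close>

lemma INT_cball_eq_Union_piece:
  assumes "finite S" "S \<noteq> {}"
  shows "(\<Inter>q\<in>S. cball q r) = (\<Union>q\<in>S. piece 1 S q r)"
proof (intro equalityI subsetI)
  fix x assume x: "x \<in> (\<Inter>q\<in>S. cball q r)"
  obtain q where q: "q \<in> S" "\<And>q'. q' \<in> S \<Longrightarrow> dist x q' \<le> dist x q"
    using obtains_MAX[OF assms, of "dist x"] assms by (metis Max_ge finite_imageI imageI)
  then have "x \<in> piece 1 S q r" using x by (auto simp: piece_def)
  then show "x \<in> (\<Union>q\<in>S. piece 1 S q r)" using q by auto
next
  fix x assume "x \<in> (\<Union>q\<in>S. piece 1 S q r)"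
  then obtain q where q: "q \<in> S" "dist q x \<le> r" "\<And>q'. q' \<in> S \<Longrightarrow> (dist x q')\<^sup>2 \<le> (dist x q)\<^sup>2"
    by (auto simp: piece_def)
  have "dist q' x \<le> r" if "q' \<in> S" for q'
    using power2_le_imp_le[OF q(3)[OF that]] q(2) by (simp add: dist_commute)
  then show "x \<in> (\<Inter>q\<in>S. cball q r)" by auto
qed

text \<open>A point of some ball also lies in the ball around its nearest centre.\<close>

lemma UN_cball_eq_Union_piece:
  assumes "finite S"
  shows "(\<Union>q\<in>S. cball q r) = (\<Union>q\<in>S. piece (-1) S q r)"
proof (intro equalityI subsetI)
  fix x assume "x \<in> (\<Union>q\<in>S. cball q r)"
  then obtain q0 where q0: "q0 \<in> S" "dist x q0 \<le> r" by (auto simp: dist_commute)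
  obtain q where q: "q \<in> S" "\<And>q'. q' \<in> S \<Longrightarrow> dist x q \<le> dist x q'"
    using obtains_MIN[OF assms, of "dist x"] assms q0 by (metis Min_le empty_iff finite_imageI imageI)
  then have "x \<in> piece (-1) S q r"
    using q(2)[OF q0(1)] q0(2) by (auto simp: piece_def dist_commute)
  then show "x \<in> (\<Union>q\<in>S. piece (-1) S q r)" using q by auto
qed (auto simp: piece_def)

section \<open>From t = 0 to r = infinity, and the order of the pole\<close>

text \<open>If \<open>h\<close> extends \<open>W\<close>, then \<open>z ^ n * h (inverse z)\<close>
  extends \<open>V\<close>, and its pole has order exactly \<open>n\<close> when \<open>h 0\<close>
  is nonzero. The lower bound on \<open>V\<close> says \<open>c \<le> W t\<close> for small positive
  \<open>t\<close>, which survives in the limit at 0.\<close>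

lemma holomorphic_at_infinity_of_right_analytic:
  fixes V W :: "real \<Rightarrow> real"
  assumes W: "right_analytic W" and VW: "\<And>r. 0 < r \<Longrightarrow> V r = r ^ n * W (1 / r)"
    and "0 < c" and low: "\<And>r. r0 \<le> r \<Longrightarrow> c * r ^ n \<le> V r"
  obtains R0 f where "0 < R0" "f holomorphic_on {z. R0 < norm z}"
    "\<And>r. R0 < r \<Longrightarrow> f (complex_of_real r) = complex_of_real (V r)"
    "pole_of_order_at_infinity f n"
proof -
  obtain \<epsilon> h where h: "\<epsilon> > 0" "h holomorphic_on ball 0 \<epsilon>"
    "\<And>t. 0 < t \<Longrightarrow> t < \<epsilon> \<Longrightarrow> h (complex_of_real t) = complex_of_real (W t)"
    using right_analyticE[OF W] by blast
  define f where "f z = z ^ n * h (inverse z)" for z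
  have inv: "norm (inverse z) < \<epsilon>" if "1 / \<epsilon> < norm z" for z :: complex
  proof -
    have "0 < norm z" using that \<open>\<epsilon> > 0\<close> by (meson divide_pos_pos less_trans zero_less_one)
    then show ?thesis using that \<open>\<epsilon> > 0\<close> unfolding norm_inverse by (simp add: field_simps)
  qed
  have nz: "z \<noteq> 0" if "1 / \<epsilon> < norm z" for z :: complex
    using that \<open>\<epsilon> > 0\<close> by auto
  have "h \<circ> inverse holomorphic_on {z. 1 / \<epsilon> < norm z}"
    by (rule holomorphic_on_compose_gen[OF _ h(2)]) (auto intro!: holomorphic_intros nz simp: inv)
  then have hol: "f holomorphic_on {z. 1 / \<epsilon> < norm z}"
    unfolding f_def by (auto intro!: holomorphic_intros simp: o_def)
  have fV: "f (complex_of_real r) = complex_of_real (V r)" if "1 / \<epsilon> < r" for r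
  proof -
    have "0 < r" using that \<open>\<epsilon> > 0\<close> by (meson divide_pos_pos less_trans zero_less_one)
    moreover from this have "1 / r < \<epsilon>" using that \<open>\<epsilon> > 0\<close> by (simp add: field_simps)
    ultimately show ?thesis
      using h(3)[of "1 / r"] VW[of r] by (simp add: f_def inverse_eq_divide)
  qed
  have "h 0 \<noteq> 0"
  proof -
    have "isCont h 0"
      using holomorphic_on_imp_continuous_on[OF h(2)] \<open>\<epsilon> > 0\<close>
      by (simp add: continuous_on_eq_continuous_at)
    moreover have "((\<lambda>t. complex_of_real t) \<longlongrightarrow> complex_of_real 0) (at_right 0)"
      by (rule tendsto_of_real[OF tendsto_ident_at])
    ultimately have "((\<lambda>t. h (complex_of_real t)) \<longlongrightarrow> h 0) (at_right 0)"
      by (intro isCont_tendsto_compose[where g = h]) simp_all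
    then have "((\<lambda>t. Re (h (complex_of_real t))) \<longlongrightarrow> Re (h 0)) (at_right 0)"
      by (intro tendsto_Re) simp
    moreover have "eventually (\<lambda>t. c \<le> Re (h (complex_of_real t))) (at_right 0)"
    proof -
      \<comment> \<open>For \<open>t < d\<close> the radius \<open>1 / t\<close> exceeds
        \<open>\<bar>r0\<bar> + 1\<close>, so \<open>low\<close> applies, also if \<open>r0\<close>
        is negative.\<close>
      define d where "d = min \<epsilon> (1 / (\<bar>r0\<bar> + 1))"
      have "0 < d" using \<open>\<epsilon> > 0\<close> by (auto simp: d_def)
      have "c \<le> Re (h (complex_of_real t))" if t: "0 < t" "t < d" for t
      proof -
        have "t < 1 / (\<bar>r0\<bar> + 1)" using t by (simp add: d_def)
        then have "\<bar>r0\<bar> + 1 < 1 / t" using t by (simp add: field_simps)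
        then have "c * (1 / t) ^ n \<le> V (1 / t)" by (intro low) linarith
        also have "\<dots> = (1 / t) ^ n * W t" using VW[of "1 / t"] t by simp
        finally have "c \<le> W t" using t by (simp add: mult.commute divide_simps)
        then show ?thesis using h(3)[of t] t by (simp add: d_def)
      qed
      then show ?thesis using \<open>0 < d\<close> by (auto simp: eventually_at_right_field)
    qed
    ultimately have "c \<le> Re (h 0)"
      by (rule tendsto_lowerbound) simp
    then show ?thesis using \<open>0 < c\<close> by auto
  qed
  moreover have "w ^ n * f (inverse w) = h w" if "w \<noteq> 0" for w
    using that by (simp add: f_def power_inverse)
  ultimately have "pole_of_order_at_infinity f n"
    unfolding pole_of_order_at_infinity_def using h by (intro exI[of _ \<epsilon>] exI[of _ h] conjI) auto
  then show ?thesis using that[OF _ hol fV] \<open>\<epsilon> > 0\<close> by simp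
qed

lemma measure_ge_of_cball_subset:
  fixes q :: "'a::euclidean_space"
  assumes "cball q (r / 2) \<subseteq> X" "compact X" "0 \<le> r"
  shows "measure lebesgue (cball (0::'a) 1) / 2 ^ DIM('a) * r ^ DIM('a) \<le> measure lebesgue X"
proof -
  have "measure lebesgue (cball q (r / 2)) = (r / 2) ^ DIM('a) * measure lebesgue (cball (0::'a) 1)"
    using content_ball_conv_unit_ball[of "r / 2" q] \<open>0 \<le> r\<close> by (simp add: content_cball_conv_ball)
  moreover have "measure lebesgue (cball q (r / 2)) \<le> measure lebesgue X"
    by (rule measure_mono_fmeasurable) (use assms in \<open>auto intro: lmeasurable_compact\<close>)
  ultimately show ?thesis by (simp add: power_divide mult.commute)
qed

theorem mainTheorem11:
  fixes p :: "nat \<Rightarrow> real ^ 'n" and N :: nat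
  assumes "N \<ge> 1"
  shows "\<exists>R. \<exists>f g.
           f holomorphic_on {z. norm z > R} \<and> g holomorphic_on {z. norm z > R} \<and>
           (\<forall>r::real. r > R \<longrightarrow> f (complex_of_real r) = complex_of_real (union_vol N p r)) \<and>
           (\<forall>r::real. r > R \<longrightarrow> g (complex_of_real r) = complex_of_real (inter_vol N p r)) \<and>
           pole_of_order_at_infinity f CARD('n) \<and> pole_of_order_at_infinity g CARD('n)"
proof -
  \<comment> \<open>Passing to the set of centres removes repetitions, which change neither the
    union nor the intersection but would make pieces coincide.\<close>
  define S where "S = p ` {..<N}"
  have S: "finite S" "S \<noteq> {}" using assms by (auto simp: S_def lessThan_empty_iff)
  then obtain q where q: "q \<in> S" by blast
  define D where "D = Max (dist q ` S)"
  have D: "dist q q' \<le> D" if "q' \<in> S" for q' using S that by (simp add: D_def)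
  have "0 \<le> D" using D[OF q] by simp
  define c where "c = measure lebesgue (cball (0 :: real ^ 'n) 1) / 2 ^ CARD('n)"
  have "c > 0" using content_cball_pos[of 1 "0 :: real ^ 'n"] by (simp add: c_def)
  have union: "union_vol N p r = measure lebesgue (\<Union>q\<in>S. cball q r)" for r
    by (simp add: union_vol_def S_def)
  have inter: "inter_vol N p r = measure lebesgue (\<Inter>q\<in>S. cball q r)" for r
    by (simp add: inter_vol_def S_def)
  \<comment> \<open>With \<open>D\<close> the largest distance from \<open>q\<close> to a centre,
    the triangle inequality gives distance at most \<open>D + r / 2 \<le> r\<close>. So one ball of
    radius \<open>r / 2\<close> lies in every ball, and bounds both volumes from below.\<close>
  have sub: "cball q (r / 2) \<subseteq> cball q' r" if "2 * D \<le> r" "q' \<in> S" for r q'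
  proof
    fix x assume "x \<in> cball q (r / 2)"
    then show "x \<in> cball q' r"
      using dist_triangle[of q' x q] D[OF that(2)] that by (auto simp: dist_commute)
  qed
  have lowU: "c * r ^ CARD('n) \<le> union_vol N p r" if "2 * D \<le> r" for r
    using measure_ge_of_cball_subset[of q r "\<Union>q\<in>S. cball q r"] sub[OF that] q S(1) that \<open>0 \<le> D\<close>
    by (force simp: union c_def)
  have "compact (\<Inter>q\<in>S. cball q r)" for r
    using S(2) by (intro compact_Inter) auto
  then have lowI: "c * r ^ CARD('n) \<le> inter_vol N p r" if "2 * D \<le> r" for r
    using measure_ge_of_cball_subset[of q r "\<Inter>q\<in>S. cball q r"] sub[OF that] that \<open>0 \<le> D\<close>
    by (force simp: inter c_def)
  obtain W1 where W1: "right_analytic W1" "\<And>r. 0 < r \<Longrightarrow> union_vol N p r = r ^ CARD('n) * W1 (1 / r)"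
    using measure_Union_piece_right_analytic[OF S(1), of "-1"]
    unfolding union UN_cball_eq_Union_piece[OF S(1)] by auto
  obtain W2 where W2: "right_analytic W2" "\<And>r. 0 < r \<Longrightarrow> inter_vol N p r = r ^ CARD('n) * W2 (1 / r)"
    using measure_Union_piece_right_analytic[OF S(1), of 1]
    unfolding inter INT_cball_eq_Union_piece[OF S] by auto
  obtain R1 f where f: "0 < R1" "f holomorphic_on {z. R1 < norm z}"
    "\<And>r. R1 < r \<Longrightarrow> f (complex_of_real r) = complex_of_real (union_vol N p r)"
    "pole_of_order_at_infinity f CARD('n)"
    using holomorphic_at_infinity_of_right_analytic[OF W1 \<open>c > 0\<close> lowU] by blast
  obtain R2 g where g: "0 < R2" "g holomorphic_on {z. R2 < norm z}"
    "\<And>r. R2 < r \<Longrightarrow> g (complex_of_real r) = complex_of_real (inter_vol N p r)"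
    "pole_of_order_at_infinity g CARD('n)"
    using holomorphic_at_infinity_of_right_analytic[OF W2 \<open>c > 0\<close> lowI] by blast
  have "f holomorphic_on {z. max R1 R2 < norm z}" "g holomorphic_on {z. max R1 R2 < norm z}"
    using f(2) g(2) by (auto elim: holomorphic_on_subset)
  then show ?thesis
    using f(3,4) g(3,4) by (intro exI[of _ "max R1 R2"] exI[of _ f] exI[of _ g]) auto
qed

end
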